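(* Let $n\ge 1$ and let $g$ be the Semi-Riemannian metric on $GL_n=GL_n(\mathbb{R})$ given by $g_A(V,W)=\mathrm{tr}(A^{-1}VA^{-1}W)$ for $A\in GL_n$, $V,W\in T_A(GL_n)=M_n(\mathbb{R})$. Let $Ric_K$ be the Ricci curvature tensor of $(GL_n,g)$ at $K\in GL_n$. Then for any $X,Y\in T_K(GL_n)=M_n(\mathbb{R})$ we have $$Ric_K(X,Y)=\tfrac12\,\mathrm{tr}(K^{-1}X)\,\mathrm{tr}(K^{-1}Y)-\tfrac n2\,g_K(X,Y).$$ Moreover $(GL_n,g)$ is a Semi-Riemannian manifold whose scalar curvature is constant and equal to $S=-\frac{(n+1)n(n-1)}{2}$.
   Context: Sign conventions: with $\nabla$ the Levi-Civita connection, $R_{XY}Z=\nabla_{[X,Y]}Z-\nabla_X\nabla_YZ+\nabla_Y\nabla_XZ$; $Ric(X,Y)$ is the trace of the linear map $Z\mapsto R_{XZ}Y$; the scalar curvature is the metric contraction (trace with respect to $g$) of $Ric$. *)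

theory Defs
  imports "HOL-Analysis.Analysis"
begin

text \<open>
  Semi-Riemannian geometry on an open subset \<open>U\<close> of a Euclidean space \<open>'a\<close>. Every tangent space
  of \<open>U\<close> is identified with \<open>'a\<close>, so a vector field on \<open>U\<close> is a function \<open>'a \<Rightarrow> 'a\<close>, smooth on
  \<open>U\<close>, whose values outside \<open>U\<close> are irrelevant.
\<close>

fun Ck_on :: "nat \<Rightarrow> ('a::euclidean_space \<Rightarrow> 'b::real_normed_vector) \<Rightarrow> 'a set \<Rightarrow> bool" where
  "Ck_on 0 f U \<longleftrightarrow> continuous_on U f"
| "Ck_on (Suc k) f U \<longleftrightarrow>
     (\<forall>p\<in>U. f differentiable (at p)) \<and>
     (\<forall>v. Ck_on k (\<lambda>p. frechet_derivative f (at p) v) U)"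

definition smooth_on :: "('a::euclidean_space \<Rightarrow> 'b::real_normed_vector) \<Rightarrow> 'a set \<Rightarrow> bool" where
  "smooth_on f U \<longleftrightarrow> (\<forall>k. Ck_on k f U)"

definition deriv_along ::
  "('a::euclidean_space \<Rightarrow> 'a) \<Rightarrow> ('a \<Rightarrow> 'b::real_normed_vector) \<Rightarrow> 'a \<Rightarrow> 'b" where
  "deriv_along X f p = frechet_derivative f (at p) (X p)"

definition lie_bracket ::
  "('a::euclidean_space \<Rightarrow> 'a) \<Rightarrow> ('a \<Rightarrow> 'a) \<Rightarrow> 'a \<Rightarrow> 'a" where
  "lie_bracket X Y p = deriv_along X Y p - deriv_along Y X p"

definition form_index :: "('a::euclidean_space \<Rightarrow> 'a \<Rightarrow> real) \<Rightarrow> nat" where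
  "form_index b = Max {dim W | W. subspace W \<and> (\<forall>w\<in>W. w \<noteq> 0 \<longrightarrow> b w w < 0)}"

text \<open>A metric assigns to each point \<open>p\<close> the form \<open>g p\<close> on the tangent space at \<open>p\<close>. The index has
  to be required constant, since \<open>U\<close> need not be connected.\<close>

definition semi_riemannian_manifold ::
  "'a::euclidean_space set \<Rightarrow> ('a \<Rightarrow> 'a \<Rightarrow> 'a \<Rightarrow> real) \<Rightarrow> bool" where
  "semi_riemannian_manifold U g \<longleftrightarrow>
     open U \<and>
     (\<forall>v w. smooth_on (\<lambda>p. g p v w) U) \<and>
     (\<forall>p\<in>U. bilinear (g p)) \<and>
     (\<forall>p\<in>U. \<forall>v w. g p v w = g p w v) \<and>
     (\<forall>p\<in>U. \<forall>v. (\<forall>w. g p v w = 0) \<longrightarrow> v = 0) \<and>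
     (\<forall>p\<in>U. \<forall>q\<in>U. form_index (g p) = form_index (g q))"

definition affine_connection ::
  "'a::euclidean_space set \<Rightarrow> (('a \<Rightarrow> 'a) \<Rightarrow> ('a \<Rightarrow> 'a) \<Rightarrow> 'a \<Rightarrow> 'a) \<Rightarrow> bool" where
  "affine_connection U D \<longleftrightarrow>
     (\<forall>X Y. smooth_on X U \<longrightarrow> smooth_on Y U \<longrightarrow> smooth_on (D X Y) U) \<and>
     (\<forall>X X' Y. \<forall>f f' :: 'a \<Rightarrow> real.
        smooth_on X U \<longrightarrow> smooth_on X' U \<longrightarrow> smooth_on Y U \<longrightarrow> smooth_on f U \<longrightarrow> smooth_on f' U \<longrightarrow>
        (\<forall>p\<in>U. D (\<lambda>q. f q *\<^sub>R X q + f' q *\<^sub>R X' q) Y p = f p *\<^sub>R D X Y p + f' p *\<^sub>R D X' Y p)) \<and>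
     (\<forall>X Y Y'. \<forall>a b :: real.
        smooth_on X U \<longrightarrow> smooth_on Y U \<longrightarrow> smooth_on Y' U \<longrightarrow>
        (\<forall>p\<in>U. D X (\<lambda>q. a *\<^sub>R Y q + b *\<^sub>R Y' q) p = a *\<^sub>R D X Y p + b *\<^sub>R D X Y' p)) \<and>
     (\<forall>X Y. \<forall>f :: 'a \<Rightarrow> real.
        smooth_on X U \<longrightarrow> smooth_on Y U \<longrightarrow> smooth_on f U \<longrightarrow>
        (\<forall>p\<in>U. D X (\<lambda>q. f q *\<^sub>R Y q) p = deriv_along X f p *\<^sub>R Y p + f p *\<^sub>R D X Y p))"

definition is_levi_civita ::
  "'a::euclidean_space set \<Rightarrow> ('a \<Rightarrow> 'a \<Rightarrow> 'a \<Rightarrow> real) \<Rightarrow>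
     (('a \<Rightarrow> 'a) \<Rightarrow> ('a \<Rightarrow> 'a) \<Rightarrow> 'a \<Rightarrow> 'a) \<Rightarrow> bool" where
  "is_levi_civita U g D \<longleftrightarrow>
     affine_connection U D \<and>
     (\<forall>X Y. smooth_on X U \<longrightarrow> smooth_on Y U \<longrightarrow>
        (\<forall>p\<in>U. D X Y p - D Y X p = lie_bracket X Y p)) \<and>
     (\<forall>X Y Z. smooth_on X U \<longrightarrow> smooth_on Y U \<longrightarrow> smooth_on Z U \<longrightarrow>
        (\<forall>p\<in>U. deriv_along X (\<lambda>q. g q (Y q) (Z q)) p =
           g p (D X Y p) (Z p) + g p (Y p) (D X Z p)))"

text \<open>\<open>SOME\<close> and not \<open>THE\<close>: the Levi-Civita connection is determined only on \<open>U\<close> and for fields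
  smooth on \<open>U\<close>.\<close>

definition levi_civita ::
  "'a::euclidean_space set \<Rightarrow> ('a \<Rightarrow> 'a \<Rightarrow> 'a \<Rightarrow> real) \<Rightarrow>
     ('a \<Rightarrow> 'a) \<Rightarrow> ('a \<Rightarrow> 'a) \<Rightarrow> 'a \<Rightarrow> 'a" where
  "levi_civita U g = (SOME D. is_levi_civita U g D)"

text \<open>The sign is the one for which the curvature of vector fields is
  \<open>R\<^bsub>XY\<^esub> Z = \<nabla>\<^bsub>[X,Y]\<^esub> Z - \<nabla>\<^sub>X \<nabla>\<^sub>Y Z + \<nabla>\<^sub>Y \<nabla>\<^sub>X Z\<close>.\<close>

definition curvature_field ::
  "'a::euclidean_space set \<Rightarrow> ('a \<Rightarrow> 'a \<Rightarrow> 'a \<Rightarrow> real) \<Rightarrow>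
     ('a \<Rightarrow> 'a) \<Rightarrow> ('a \<Rightarrow> 'a) \<Rightarrow> ('a \<Rightarrow> 'a) \<Rightarrow> 'a \<Rightarrow> 'a" where
  "curvature_field U g X Y Z =
     (let D = levi_civita U g in
       (\<lambda>p. D (lie_bracket X Y) Z p - D X (D Y Z) p + D Y (D X Z) p))"

text \<open>The curvature tensor on tangent vectors at \<open>p\<close>: the common value for all extensions of
  \<open>x\<close>, \<open>y\<close>, \<open>z\<close> to vector fields.\<close>

definition curvature_tensor ::
  "'a::euclidean_space set \<Rightarrow> ('a \<Rightarrow> 'a \<Rightarrow> 'a \<Rightarrow> real) \<Rightarrow> 'a \<Rightarrow> 'a \<Rightarrow> 'a \<Rightarrow> 'a \<Rightarrow> 'a" where
  "curvature_tensor U g p x y z =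
     (THE r. \<forall>X Y Z. smooth_on X U \<longrightarrow> smooth_on Y U \<longrightarrow> smooth_on Z U \<longrightarrow>
        X p = x \<longrightarrow> Y p = y \<longrightarrow> Z p = z \<longrightarrow> curvature_field U g X Y Z p = r)"

definition linear_trace :: "('a::euclidean_space \<Rightarrow> 'a) \<Rightarrow> real" where
  "linear_trace f = (\<Sum>b\<in>Basis. f b \<bullet> b)"

definition ricci ::
  "'a::euclidean_space set \<Rightarrow> ('a \<Rightarrow> 'a \<Rightarrow> 'a \<Rightarrow> real) \<Rightarrow> 'a \<Rightarrow> 'a \<Rightarrow> 'a \<Rightarrow> real" where
  "ricci U g p x y = linear_trace (\<lambda>z. curvature_tensor U g p x z y)"

text \<open>The contraction of a bilinear form \<open>B\<close> with respect to a nondegenerate form \<open>b\<close>: the trace of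
  the endomorphism \<open>Q\<close> with \<open>b (Q x) y = B x y\<close>.\<close>

definition metric_trace ::
  "('a::euclidean_space \<Rightarrow> 'a \<Rightarrow> real) \<Rightarrow> ('a \<Rightarrow> 'a \<Rightarrow> real) \<Rightarrow> real" where
  "metric_trace b B = linear_trace (\<lambda>x. THE w. \<forall>y. b w y = B x y)"

definition scalar_curvature ::
  "'a::euclidean_space set \<Rightarrow> ('a \<Rightarrow> 'a \<Rightarrow> 'a \<Rightarrow> real) \<Rightarrow> 'a \<Rightarrow> real" where
  "scalar_curvature U g p = metric_trace (g p) (ricci U g p)"

definition GL :: "(real^'n^'n) set" where
  "GL = {A. invertible A}"

definition gl_metric :: "real^'n^'n \<Rightarrow> real^'n^'n \<Rightarrow> real^'n^'n \<Rightarrow> real" where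
  "gl_metric A V W = trace (matrix_inv A ** V ** matrix_inv A ** W)"

end

theory Submission
  imports Defs
begin

text \<open>
  Write \<open>A = K\<^sup>-\<^sup>1\<close>. Differentiating \<open>tr (A V A W)\<close> shows that
  \<open>\<nabla>\<^sub>X Y = dY(X) - (X A Y + Y A X) / 2\<close> is torsion-free and metric; by uniqueness it is the
  Levi-Civita connection. The second derivatives of \<open>Z\<close> drop out of \<open>R\<^bsub>XY\<^esub> Z\<close> because they are
  symmetric, and what remains is the curvature of a bi-invariant metric,
  \<open>R\<^bsub>XY\<^esub> Z = (X A Y A Z - Y A X A Z - Z A X A Y + Z A Y A X) / 4\<close>. Both traces then follow
  from the fact that \<open>Z \<mapsto> B Z C\<close> has trace \<open>tr B tr C\<close>.
\<close>

subsection \<open>Smooth maps\<close>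

text \<open>The definitions by choice shape the work. \<open>levi_civita\<close> is a
  \<open>SOME\<close>, so it is reached only through existence (an explicit connection) together
  with uniqueness, and only on \<open>GL\<close> and for fields smooth there.
  \<open>curvature_tensor\<close> is a \<open>THE\<close> over all smooth extensions of the given
  vectors, so the curvature formula is proved for arbitrary smooth fields. That brings second
  derivatives into the computation, and with them the symmetry of mixed derivatives.
  \<open>GL\<close> is disconnected, so constancy of the index cannot come from continuity alone; it
  comes from left multiplication by \<open>q ** matrix_inv p\<close>, an isometry between the
  tangent spaces at any two points. The scalar curvature arises as n/2 - (n/2) n^2: the Ricci
  endomorphism is a rank one map of trace n/2 minus n/2 times the identity of a space of dimension
  n^2.\<close>

lemma has_derivative_cong_open:
  assumes "open U" "p \<in> U" "\<And>q. q \<in> U \<Longrightarrow> f q = g q"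
  shows "(f has_derivative f') (at p) \<longleftrightarrow> (g has_derivative f') (at p)"
  using has_derivative_transform_within_open[of f f' p UNIV U g]
    has_derivative_transform_within_open[of g f' p UNIV U f] assms by auto

lemma frechet_derivative_cong_open:
  assumes "open U" "p \<in> U" "\<And>q. q \<in> U \<Longrightarrow> f q = g q"
  shows "frechet_derivative f (at p) = frechet_derivative g (at p)"
  unfolding frechet_derivative_def
  using has_derivative_cong_open[of U p f g] assms by simp

lemma frechet_derivative_eqI:
  "(f has_derivative f') (at p) \<Longrightarrow> frechet_derivative f (at p) = f'"
  using frechet_derivative_at by metis

lemma Ck_on_cong:
  assumes "open U" "\<And>q. q \<in> U \<Longrightarrow> f q = g q"
  shows "Ck_on k f U \<longleftrightarrow> Ck_on k g U"
  using assms(2)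
proof (induction k arbitrary: f g)
  case 0
  then show ?case using continuous_on_cong[OF refl, of U f g] by simp
next
  case (Suc k)
  have "f differentiable (at p) \<longleftrightarrow> g differentiable (at p)" if "p \<in> U" for p
    unfolding differentiable_def using has_derivative_cong_open[OF assms(1) that Suc.prems] by simp
  moreover have "Ck_on k (\<lambda>p. frechet_derivative f (at p) v) U
      \<longleftrightarrow> Ck_on k (\<lambda>p. frechet_derivative g (at p) v) U" for v
    using frechet_derivative_cong_open[OF assms(1) _ Suc.prems] by (intro Suc.IH) simp
  ultimately show ?case by simp
qed

text \<open>Congruence on the open set lets a closed formula \<open>f'\<close>, known on
  \<open>U\<close> alone, stand in for \<open>frechet_derivative\<close> at the next level.\<close>

lemma Ck_on_SucI:
  assumes "open U" "\<And>p. p \<in> U \<Longrightarrow> (f has_derivative f' p) (at p)"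
    and "\<And>v. Ck_on k (\<lambda>p. f' p v) U"
  shows "Ck_on (Suc k) f U"
proof -
  have "Ck_on k (\<lambda>p. frechet_derivative f (at p) v) U" for v
    using assms(3)[of v] Ck_on_cong[OF assms(1), of "\<lambda>p. frechet_derivative f (at p) v" "\<lambda>p. f' p v" k]
      frechet_derivative_eqI[OF assms(2)] by simp
  then show ?thesis using assms(2) by (auto simp: differentiable_def)
qed

lemma Ck_on_SucD: "Ck_on (Suc k) f U \<Longrightarrow> Ck_on k f U"
proof (induction k arbitrary: f)
  case 0
  then show ?case
    by (auto intro!: continuous_at_imp_continuous_on differentiable_imp_continuous_within)
next
  case (Suc k)
  then show ?case by (metis Ck_on.simps(2))
qed

lemma Ck_on_const: "Ck_on k (\<lambda>p. c) U"
  by (induction k arbitrary: c) simp_all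

lemma has_derivative_frechet:
  "f differentiable (at p) \<Longrightarrow> (f has_derivative (frechet_derivative f (at p))) (at p)"
  using frechet_derivative_works by blast

lemma Ck_on_bounded_linear:
  assumes "open U" "bounded_linear L" "Ck_on k f U"
  shows "Ck_on k (\<lambda>p. L (f p)) U"
  using assms(3)
proof (induction k arbitrary: f)
  case 0
  then show ?case by (simp add: bounded_linear.continuous_on[OF assms(2)])
next
  case (Suc k)
  show ?case
    by (rule Ck_on_SucI[OF assms(1), of _ "\<lambda>p v. L (frechet_derivative f (at p) v)"])
      (use Suc in \<open>auto intro!: bounded_linear.has_derivative[OF assms(2)] has_derivative_frechet\<close>)
qed

lemma Ck_on_add:
  assumes "open U" "Ck_on k f U" "Ck_on k g U"
  shows "Ck_on k (\<lambda>p. f p + g p) U"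
  using assms(2,3)
proof (induction k arbitrary: f g)
  case 0
  then show ?case by (simp add: continuous_on_add)
next
  case (Suc k)
  show ?case
    by (rule Ck_on_SucI[OF assms(1),
          of _ "\<lambda>p v. frechet_derivative f (at p) v + frechet_derivative g (at p) v"])
      (use Suc in \<open>auto intro!: has_derivative_add has_derivative_frechet\<close>)
qed

text \<open>The product rule pairs each derivative with an undifferentiated factor, so the induction
  hypothesis must be fed \<open>f\<close> and \<open>g\<close> themselves at level \<open>k\<close>;
  \<open>Ck_on_SucD\<close> supplies this.\<close>

lemma Ck_on_bounded_bilinear:
  assumes "open U" "bounded_bilinear B" "Ck_on k f U" "Ck_on k g U"
  shows "Ck_on k (\<lambda>p. B (f p) (g p)) U"
  using assms(3,4)
proof (induction k arbitrary: f g)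
  case 0
  then show ?case by (simp add: bounded_bilinear.continuous_on[OF assms(2)])
next
  case (Suc k)
  have "Ck_on k f U" "Ck_on k g U"
    using Suc.prems Ck_on_SucD by auto
  then show ?case
    by (intro Ck_on_SucI[OF assms(1), of _ "\<lambda>p v. B (f p) (frechet_derivative g (at p) v)
          + B (frechet_derivative f (at p) v) (g p)"] Ck_on_add[OF assms(1)])
      (use Suc in \<open>auto intro!: bounded_bilinear.FDERIV[OF assms(2)] has_derivative_frechet\<close>)
qed

lemma smooth_on_cong:
  assumes "open U" "\<And>q. q \<in> U \<Longrightarrow> f q = g q"
  shows "smooth_on f U \<longleftrightarrow> smooth_on g U"
  unfolding smooth_on_def using Ck_on_cong[OF assms] by simp

lemma smooth_on_const: "smooth_on (\<lambda>p. c) U"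
  by (simp add: smooth_on_def Ck_on_const)

lemma smooth_on_bounded_linear:
  "open U \<Longrightarrow> bounded_linear L \<Longrightarrow> smooth_on f U \<Longrightarrow> smooth_on (\<lambda>p. L (f p)) U"
  by (simp add: smooth_on_def Ck_on_bounded_linear)

lemma smooth_on_bounded_bilinear:
  "open U \<Longrightarrow> bounded_bilinear B \<Longrightarrow> smooth_on f U \<Longrightarrow> smooth_on g U
    \<Longrightarrow> smooth_on (\<lambda>p. B (f p) (g p)) U"
  by (simp add: smooth_on_def Ck_on_bounded_bilinear)

lemma smooth_on_add:
  "open U \<Longrightarrow> smooth_on f U \<Longrightarrow> smooth_on g U \<Longrightarrow> smooth_on (\<lambda>p. f p + g p) U"
  by (simp add: smooth_on_def Ck_on_add)

lemma smooth_on_scaleR: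
  "open U \<Longrightarrow> smooth_on f U \<Longrightarrow> smooth_on g U \<Longrightarrow> smooth_on (\<lambda>p. f p *\<^sub>R g p) U"
  by (rule smooth_on_bounded_bilinear[OF _ bounded_bilinear_scaleR])

lemma smooth_on_diff:
  assumes "open U" "smooth_on f U" "smooth_on g U"
  shows "smooth_on (\<lambda>p. f p - g p) U"
  using smooth_on_add[OF assms(1,2) smooth_on_bounded_linear[OF assms(1) _ assms(3), of uminus]]
  by (simp add: bounded_linear_minus bounded_linear_ident)

lemma smooth_on_sum:
  "open U \<Longrightarrow> (\<And>i. i \<in> I \<Longrightarrow> smooth_on (f i) U) \<Longrightarrow> smooth_on (\<lambda>p. \<Sum>i\<in>I. f i p) U"
  by (induction I rule: infinite_finite_induct) (auto simp: smooth_on_const smooth_on_add)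

lemma smooth_on_differentiable: "smooth_on f U \<Longrightarrow> p \<in> U \<Longrightarrow> f differentiable (at p)"
  unfolding smooth_on_def using Ck_on.simps(2) by blast

lemma smooth_on_has_derivative:
  "smooth_on f U \<Longrightarrow> p \<in> U \<Longrightarrow> (f has_derivative (frechet_derivative f (at p))) (at p)"
  by (simp add: smooth_on_differentiable has_derivative_frechet)

lemma smooth_on_frechet_derivative:
  "smooth_on f U \<Longrightarrow> smooth_on (\<lambda>p. frechet_derivative f (at p) v) U"
  unfolding smooth_on_def using Ck_on.simps(2) by blast

text \<open>Trades a direction that varies with the point for fixed basis directions with scalar
  coefficients. \<open>Ck_on\<close> differentiates in fixed directions only, so
  \<open>deriv_along\<close> is treated in this form.\<close>

lemma frechet_derivative_eq_sum_Basis: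
  fixes f :: "'a::euclidean_space \<Rightarrow> 'b::real_normed_vector"
  assumes "f differentiable (at p)"
  shows "frechet_derivative f (at p) v = (\<Sum>b\<in>Basis. (v \<bullet> b) *\<^sub>R frechet_derivative f (at p) b)"
proof -
  interpret linear "frechet_derivative f (at p)"
    using assms by (rule linear_frechet_derivative)
  have "frechet_derivative f (at p) v = frechet_derivative f (at p) (\<Sum>b\<in>Basis. (v \<bullet> b) *\<^sub>R b)"
    by (simp add: euclidean_representation)
  then show ?thesis by (simp add: sum scale)
qed

lemma smooth_on_deriv_along:
  assumes "open U" "smooth_on X U" "smooth_on f U"
  shows "smooth_on (deriv_along X f) U"
proof -
  have "smooth_on (\<lambda>p. \<Sum>b\<in>Basis. (X p \<bullet> b) *\<^sub>R frechet_derivative f (at p) b) U"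
    using assms by (intro smooth_on_sum smooth_on_scaleR smooth_on_frechet_derivative
        smooth_on_bounded_linear[of U "\<lambda>x. x \<bullet> _"] bounded_linear_inner_left)
  then show ?thesis
    using smooth_on_cong[OF assms(1), of "deriv_along X f"
        "\<lambda>p. \<Sum>b\<in>Basis. (X p \<bullet> b) *\<^sub>R frechet_derivative f (at p) b"]
      frechet_derivative_eq_sum_Basis[OF smooth_on_differentiable[OF assms(3)]]
    by (simp add: deriv_along_def)
qed

lemma smooth_on_lie_bracket:
  "open U \<Longrightarrow> smooth_on X U \<Longrightarrow> smooth_on Y U \<Longrightarrow> smooth_on (lie_bracket X Y) U"
  using smooth_on_diff[OF _ smooth_on_deriv_along smooth_on_deriv_along, of U X Y Y X]
  by (simp add: lie_bracket_def[abs_def])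

subsection \<open>Symmetry of second derivatives\<close>

text \<open>The mean value theorem is applied twice: along \<open>u\<close> to the difference of
  \<open>f\<close> on two parallel segments, then along \<open>v\<close> to the resulting
  \<open>u\<close> derivative. Swapping \<open>u\<close> and \<open>v\<close> leaves the second
  difference unchanged, which is the source of symmetry.\<close>

lemma second_difference_mvt:
  fixes f :: "'a::euclidean_space \<Rightarrow> real"
  assumes f: "\<And>q. q \<in> U \<Longrightarrow> f differentiable (at q)"
    and fu: "\<And>q. q \<in> U \<Longrightarrow> (\<lambda>q. frechet_derivative f (at q) u) differentiable (at q)"
    and "t > 0"
    and U: "\<And>s s'. 0 \<le> s \<Longrightarrow> s \<le> t \<Longrightarrow> 0 \<le> s' \<Longrightarrow> s' \<le> t \<Longrightarrow> p + s *\<^sub>R u + s' *\<^sub>R v \<in> U"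
  obtains s s' where "0 \<le> s" "s \<le> t" "0 \<le> s'" "s' \<le> t"
    "f (p + t *\<^sub>R u + t *\<^sub>R v) - f (p + t *\<^sub>R u) - f (p + t *\<^sub>R v) + f p =
      t\<^sup>2 * frechet_derivative (\<lambda>q. frechet_derivative f (at q) u) (at (p + s *\<^sub>R u + s' *\<^sub>R v)) v"
proof -
  let ?D = "\<lambda>h q. frechet_derivative h (at q)"
  have *: "((\<lambda>s. h (a + s *\<^sub>R w)) has_real_derivative ?D h (a + s *\<^sub>R w) w) (at s)"
    if "h differentiable (at (a + s *\<^sub>R w))" for h :: "'a \<Rightarrow> real" and a w s
  proof -
    have "((\<lambda>s. h (a + s *\<^sub>R w)) has_derivative (\<lambda>x. ?D h (a + s *\<^sub>R w) (x *\<^sub>R w))) (at s)"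
      by (rule has_derivative_compose[where f = "\<lambda>s. a + s *\<^sub>R w" and g = h])
        (auto intro!: derivative_eq_intros has_derivative_frechet that)
    moreover have "?D h (a + s *\<^sub>R w) (x *\<^sub>R w) = ?D h (a + s *\<^sub>R w) w * x" for x
      using linear_cmul[OF linear_frechet_derivative[OF that]] by simp
    ultimately show ?thesis by (simp add: has_field_derivative_def)
  qed
  have "((\<lambda>s. f (p + s *\<^sub>R u + t *\<^sub>R v) - f (p + s *\<^sub>R u)) has_real_derivative
      ?D f (p + s *\<^sub>R u + t *\<^sub>R v) u - ?D f (p + s *\<^sub>R u) u) (at s)" if "0 \<le> s" "s \<le> t" for s
    using *[OF f, of "p + t *\<^sub>R v" s u] *[OF f, of p s u] U[OF that, of t] U[OF that, of 0] \<open>t > 0\<close>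
    by (auto intro!: DERIV_diff simp: add_ac)
  from MVT2[OF \<open>t > 0\<close> this] obtain s where s: "0 < s" "s < t"
    "f (p + t *\<^sub>R u + t *\<^sub>R v) - f (p + t *\<^sub>R u) - (f (p + t *\<^sub>R v) - f p) =
      t * (?D f (p + s *\<^sub>R u + t *\<^sub>R v) u - ?D f (p + s *\<^sub>R u) u)" by auto
  have "((\<lambda>s'. ?D f (p + s *\<^sub>R u + s' *\<^sub>R v) u) has_real_derivative
      ?D (\<lambda>q. ?D f q u) (p + s *\<^sub>R u + s' *\<^sub>R v) v) (at s')" if "0 \<le> s'" "s' \<le> t" for s'
    using *[OF fu, of "p + s *\<^sub>R u" s' v] U[of s s'] s that by simp
  from MVT2[OF \<open>t > 0\<close> this] obtain s' where s': "0 < s'" "s' < t"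
    "?D f (p + s *\<^sub>R u + t *\<^sub>R v) u - ?D f (p + s *\<^sub>R u) u =
      t * ?D (\<lambda>q. ?D f q u) (p + s *\<^sub>R u + s' *\<^sub>R v) v" by auto
  show ?thesis
    using that[of s s'] s s' by (simp add: power2_eq_square algebra_simps)
qed

lemma clairaut_real:
  fixes f :: "'a::euclidean_space \<Rightarrow> real"
  assumes "open U" "p \<in> U" and f: "smooth_on f U"
  shows "frechet_derivative (\<lambda>q. frechet_derivative f (at q) u) (at p) v =
    frechet_derivative (\<lambda>q. frechet_derivative f (at q) v) (at p) u"
proof (rule ccontr)
  define A where "A u v q = frechet_derivative (\<lambda>q. frechet_derivative f (at q) u) (at q) v" for u v q
  assume "\<not> ?thesis"
  then have ne: "A u v p \<noteq> A v u p" by (simp add: A_def)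
  \<comment> \<open>Half the gap: values strictly within \<open>e\<close> of the two ends cannot
    coincide.\<close>
  define e where "e = \<bar>A u v p - A v u p\<bar> / 2"
  have "e > 0" using ne by (simp add: e_def)
  have smooth: "smooth_on (A u v) U" for u v
    unfolding A_def[abs_def] by (intro smooth_on_frechet_derivative f)
  have cont: "isCont (A u v) p" for u v
    by (rule differentiable_imp_continuous_within[OF smooth_on_differentiable[OF smooth \<open>p \<in> U\<close>]])
  have near: "\<forall>\<^sub>F q in nhds p. dist (A u v q) (A u v p) < e" for u v
    using cont[of u v] \<open>e > 0\<close>
    by (metis continuous_within tendsto_at_iff_tendsto_nhds tendsto_iff)
  have "\<forall>\<^sub>F q in nhds p. q \<in> U \<and> dist (A u v q) (A u v p) < e \<and> dist (A v u q) (A v u p) < e"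
    using near[of u v] near[of v u] assms(1,2)
    by (auto intro!: eventually_conj eventually_nhds_in_open)
  then obtain r where r: "r > 0"
    "\<And>q. dist q p < r \<Longrightarrow> q \<in> U \<and> dist (A u v q) (A u v p) < e \<and> dist (A v u q) (A v u p) < e"
    unfolding eventually_nhds_metric by blast
  \<comment> \<open>Keeps the whole parallelogram spanned by \<open>t *\<^sub>R u\<close> and
    \<open>t *\<^sub>R v\<close> within distance \<open>r\<close> of \<open>p\<close>; the summand 1
    keeps the denominator positive when both vectors vanish.\<close>
  define t where "t = r / (norm u + norm v + 1)"
  have pos: "norm u + norm v + 1 > 0"
    by (meson add_nonneg_pos add_nonneg_nonneg norm_ge_zero zero_less_one)
  then have "t > 0" using r by (simp add: t_def)
  have small: "dist (p + s *\<^sub>R u + s' *\<^sub>R v) p < r" if "0 \<le> s" "s \<le> t" "0 \<le> s'" "s' \<le> t" for s s'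
  proof -
    have "dist (p + s *\<^sub>R u + s' *\<^sub>R v) p = norm (s *\<^sub>R u + s' *\<^sub>R v)"
      by (simp add: dist_norm algebra_simps)
    also have "\<dots> \<le> s * norm u + s' * norm v"
      using norm_triangle_ineq[of "s *\<^sub>R u" "s' *\<^sub>R v"] that by simp
    also have "\<dots> \<le> t * norm u + t * norm v"
      using that by (intro add_mono mult_right_mono) auto
    also have "\<dots> < t * (norm u + norm v + 1)" using \<open>t > 0\<close> by (simp add: algebra_simps)
    also have "\<dots> = r" using pos by (simp add: t_def)
    finally show ?thesis .
  qed
  have d: "f differentiable (at q)" "(\<lambda>q. frechet_derivative f (at q) w) differentiable (at q)"
    if "q \<in> U" for q w
    using that f smooth_on_differentiable smooth_on_frechet_derivative by blast+
  obtain s1 s1' where 1: "0 \<le> s1" "s1 \<le> t" "0 \<le> s1'" "s1' \<le> t"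
    "f (p + t *\<^sub>R u + t *\<^sub>R v) - f (p + t *\<^sub>R u) - f (p + t *\<^sub>R v) + f p
      = t\<^sup>2 * A u v (p + s1 *\<^sub>R u + s1' *\<^sub>R v)"
    by (rule second_difference_mvt[OF d \<open>t > 0\<close>, of U p u v]) (simp_all add: A_def small r(2))
  have small': "dist (p + s *\<^sub>R v + s' *\<^sub>R u) p < r" if "0 \<le> s" "s \<le> t" "0 \<le> s'" "s' \<le> t" for s s'
    using small[of s' s] that by (simp add: add_ac)
  obtain s2 s2' where 2: "0 \<le> s2" "s2 \<le> t" "0 \<le> s2'" "s2' \<le> t"
    "f (p + t *\<^sub>R v + t *\<^sub>R u) - f (p + t *\<^sub>R v) - f (p + t *\<^sub>R u) + f p
      = t\<^sup>2 * A v u (p + s2 *\<^sub>R v + s2' *\<^sub>R u)"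
    by (rule second_difference_mvt[OF d \<open>t > 0\<close>, of U p v u]) (simp_all add: A_def small' r(2))
  have comm: "p + t *\<^sub>R v + t *\<^sub>R u = p + t *\<^sub>R u + t *\<^sub>R v" by simp
  have "t\<^sup>2 * A u v (p + s1 *\<^sub>R u + s1' *\<^sub>R v) = t\<^sup>2 * A v u (p + s2 *\<^sub>R v + s2' *\<^sub>R u)"
    using 1(5) 2(5)[unfolded comm] by linarith
  then have "A u v (p + s1 *\<^sub>R u + s1' *\<^sub>R v) = A v u (p + s2 *\<^sub>R v + s2' *\<^sub>R u)"
    using \<open>t > 0\<close> by simp
  moreover have "\<bar>A u v (p + s1 *\<^sub>R u + s1' *\<^sub>R v) - A u v p\<bar> < e"
    "\<bar>A v u (p + s2 *\<^sub>R v + s2' *\<^sub>R u) - A v u p\<bar> < e"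
    using r(2)[OF small[OF 1(1-4)]] r(2)[OF small'[OF 2(1-4)]] by (simp_all add: dist_real_def)
  moreover have "\<bar>A u v p - A v u p\<bar> = 2 * e" by (simp add: e_def)
  ultimately show False by (simp add: abs_if split: if_splits)
qed

text \<open>The mean value argument needs real values, so the claim is tested on components.\<close>

lemma clairaut:
  fixes f :: "'a::euclidean_space \<Rightarrow> 'b::euclidean_space"
  assumes "open U" "p \<in> U" and f: "smooth_on f U"
  shows "frechet_derivative (\<lambda>q. frechet_derivative f (at q) u) (at p) v =
    frechet_derivative (\<lambda>q. frechet_derivative f (at q) v) (at p) u"
proof (rule euclidean_eqI)
  fix b :: 'b
  have inner: "frechet_derivative (\<lambda>q. h q \<bullet> b) (at q) w = frechet_derivative h (at q) w \<bullet> b"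
    if "smooth_on h U" "q \<in> U" for h :: "'a \<Rightarrow> 'b" and q w
    by (subst frechet_derivative_eqI[OF has_derivative_inner_left[OF smooth_on_has_derivative]])
      (use that in auto)
  have second: "frechet_derivative (\<lambda>q. frechet_derivative f (at q) u) (at p) v \<bullet> b =
    frechet_derivative (\<lambda>q. frechet_derivative (\<lambda>q. f q \<bullet> b) (at q) u) (at p) v" for u v
    using inner[OF smooth_on_frechet_derivative[OF f] \<open>p \<in> U\<close>, of u v]
      frechet_derivative_cong_open[OF assms(1,2), of "\<lambda>q. frechet_derivative f (at q) u \<bullet> b"
        "\<lambda>q. frechet_derivative (\<lambda>q. f q \<bullet> b) (at q) u"] inner[OF f]
    by simp
  have "smooth_on (\<lambda>q. f q \<bullet> b) U"
    using assms by (intro smooth_on_bounded_linear[of U "\<lambda>x. x \<bullet> _"] bounded_linear_inner_left)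
  from clairaut_real[OF assms(1,2) this, of u v]
  show "frechet_derivative (\<lambda>q. frechet_derivative f (at q) u) (at p) v \<bullet> b =
    frechet_derivative (\<lambda>q. frechet_derivative f (at q) v) (at p) u \<bullet> b"
    by (simp add: second)
qed

lemma has_derivative_deriv_along:
  fixes Y :: "'a::euclidean_space \<Rightarrow> 'a" and Z :: "'a \<Rightarrow> 'b::real_normed_vector"
  assumes "open U" "p \<in> U" and Y: "smooth_on Y U" and Z: "smooth_on Z U"
  shows "(deriv_along Y Z has_derivative
    (\<lambda>u. (\<Sum>b\<in>Basis. (Y p \<bullet> b) *\<^sub>R frechet_derivative (\<lambda>q. frechet_derivative Z (at q) b) (at p) u)
      + frechet_derivative Z (at p) (frechet_derivative Y (at p) u))) (at p)"
proof -
  have "((\<lambda>q. \<Sum>b\<in>Basis. (Y q \<bullet> b) *\<^sub>R frechet_derivative Z (at q) b) has_derivative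
    (\<lambda>u. \<Sum>b\<in>Basis. (Y p \<bullet> b) *\<^sub>R frechet_derivative (\<lambda>q. frechet_derivative Z (at q) b) (at p) u
      + (frechet_derivative Y (at p) u \<bullet> b) *\<^sub>R frechet_derivative Z (at p) b)) (at p)"
    by (intro has_derivative_sum has_derivative_scaleR has_derivative_inner_left
        smooth_on_has_derivative[OF _ assms(2)] smooth_on_frechet_derivative Y Z)
  then show ?thesis
    using has_derivative_cong_open[OF assms(1,2), of "deriv_along Y Z"
        "\<lambda>q. \<Sum>b\<in>Basis. (Y q \<bullet> b) *\<^sub>R frechet_derivative Z (at q) b"]
      frechet_derivative_eq_sum_Basis[OF smooth_on_differentiable[OF Z]] assms(2)
    by (simp add: deriv_along_def sum.distrib)
qed

text \<open>The Hessian of \<open>Z\<close> enters the two iterated derivatives with its arguments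
  \<open>X p\<close> and \<open>Y p\<close> exchanged; \<open>clairaut\<close> makes the two
  contributions equal. What is left is first order: \<open>Z\<close> differentiated along the
  bracket.\<close>

lemma deriv_along_lie_bracket:
  fixes X Y :: "'a::euclidean_space \<Rightarrow> 'a" and Z :: "'a \<Rightarrow> 'b::euclidean_space"
  assumes "open U" "p \<in> U" and X: "smooth_on X U" and Y: "smooth_on Y U" and Z: "smooth_on Z U"
  shows "deriv_along (lie_bracket X Y) Z p =
    deriv_along X (deriv_along Y Z) p - deriv_along Y (deriv_along X Z) p"
proof -
  define H where "H b c = frechet_derivative (\<lambda>q. frechet_derivative Z (at q) b) (at p) c" for b c
  have sym: "H b c = H c b" for b c
    unfolding H_def by (rule clairaut[OF assms(1,2) Z])
  have lin: "H b v = (\<Sum>c\<in>Basis. (v \<bullet> c) *\<^sub>R H b c)" for b v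
    unfolding H_def
    by (rule frechet_derivative_eq_sum_Basis[OF smooth_on_differentiable[OF _ assms(2)]])
      (intro smooth_on_frechet_derivative Z)
  have eq: "deriv_along X (deriv_along Y Z) p = (\<Sum>b\<in>Basis. \<Sum>c\<in>Basis. (Y p \<bullet> b) *\<^sub>R (X p \<bullet> c) *\<^sub>R H b c)
      + frechet_derivative Z (at p) (deriv_along X Y p)"
    if "smooth_on X U" "smooth_on Y U" for X Y :: "'a \<Rightarrow> 'a"
    unfolding deriv_along_def[of X]
      frechet_derivative_eqI[OF has_derivative_deriv_along[OF assms(1,2) that(2) Z]]
    by (simp flip: H_def) (simp add: lin[of _ "X p"] scaleR_sum_right)
  have "(\<Sum>b\<in>Basis. \<Sum>c\<in>Basis. (Y p \<bullet> b) *\<^sub>R (X p \<bullet> c) *\<^sub>R H b c) =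
    (\<Sum>b\<in>Basis. \<Sum>c\<in>Basis. (X p \<bullet> b) *\<^sub>R (Y p \<bullet> c) *\<^sub>R H b c)"
    by (subst sum.swap) (simp add: sym mult.commute)
  then show ?thesis
    using eq[OF X Y] eq[OF Y X]
      linear_diff[OF linear_frechet_derivative[OF smooth_on_differentiable[OF Z assms(2)]]]
    by (simp add: deriv_along_def[of "lie_bracket X Y"] lie_bracket_def)
qed

subsection \<open>The Levi-Civita connection\<close>

text \<open>\<open>deriv_along\<close> is the flat connection and carries the whole Leibniz term;
  the correction is linear over functions in both arguments, so the axioms survive adding
  it.\<close>

lemma affine_connection_christoffel:
  fixes U :: "'a::euclidean_space set"
  assumes "open U"
    and bilin: "\<And>p. p \<in> U \<Longrightarrow> bilinear (G p)"
    and smooth: "\<And>X Y. smooth_on X U \<Longrightarrow> smooth_on Y U \<Longrightarrow> smooth_on (\<lambda>p. G p (X p) (Y p)) U"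
  shows "affine_connection U (\<lambda>X Y p. deriv_along X Y p + G p (X p) (Y p))"
  unfolding affine_connection_def
proof (intro conjI allI impI ballI)
  show "smooth_on (\<lambda>p. deriv_along X Y p + G p (X p) (Y p)) U"
    if "smooth_on X U" "smooth_on Y U" for X Y :: "'a \<Rightarrow> 'a"
    using that assms by (intro smooth_on_add smooth_on_deriv_along)
next
  fix X X' Y :: "'a \<Rightarrow> 'a" and f f' :: "'a \<Rightarrow> real" and p
  assume Y: "smooth_on Y U" and p: "p \<in> U"
  interpret linear "frechet_derivative Y (at p)"
    by (rule linear_frechet_derivative[OF smooth_on_differentiable[OF Y p]])
  show "deriv_along (\<lambda>q. f q *\<^sub>R X q + f' q *\<^sub>R X' q) Y p +
      G p (f p *\<^sub>R X p + f' p *\<^sub>R X' p) (Y p) =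
    f p *\<^sub>R (deriv_along X Y p + G p (X p) (Y p)) + f' p *\<^sub>R (deriv_along X' Y p + G p (X' p) (Y p))"
    using bilin[OF p]
    by (simp add: deriv_along_def add scale bilinear_ladd bilinear_lmul algebra_simps)
next
  fix X Y Y' :: "'a \<Rightarrow> 'a" and a b :: real and p
  assume Y: "smooth_on Y U" and Y': "smooth_on Y' U" and p: "p \<in> U"
  have "frechet_derivative (\<lambda>q. a *\<^sub>R Y q + b *\<^sub>R Y' q) (at p) =
      (\<lambda>u. a *\<^sub>R frechet_derivative Y (at p) u + b *\<^sub>R frechet_derivative Y' (at p) u)"
    by (intro frechet_derivative_eqI has_derivative_add has_derivative_scaleR_right
        smooth_on_has_derivative[OF _ p] Y Y')
  then show "deriv_along X (\<lambda>q. a *\<^sub>R Y q + b *\<^sub>R Y' q) p + G p (X p) (a *\<^sub>R Y p + b *\<^sub>R Y' p) =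
    a *\<^sub>R (deriv_along X Y p + G p (X p) (Y p)) + b *\<^sub>R (deriv_along X Y' p + G p (X p) (Y' p))"
    using bilin[OF p]
    by (simp add: deriv_along_def bilinear_radd bilinear_rmul algebra_simps)
next
  fix X Y :: "'a \<Rightarrow> 'a" and f :: "'a \<Rightarrow> real" and p
  assume Y: "smooth_on Y U" and f: "smooth_on f U" and p: "p \<in> U"
  have "frechet_derivative (\<lambda>q. f q *\<^sub>R Y q) (at p) =
      (\<lambda>u. f p *\<^sub>R frechet_derivative Y (at p) u + frechet_derivative f (at p) u *\<^sub>R Y p)"
    by (intro frechet_derivative_eqI has_derivative_scaleR
        smooth_on_has_derivative[OF _ p] Y f)
  then show "deriv_along X (\<lambda>q. f q *\<^sub>R Y q) p + G p (X p) (f p *\<^sub>R Y p) =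
    deriv_along X f p *\<^sub>R Y p + f p *\<^sub>R (deriv_along X Y p + G p (X p) (Y p))"
    using bilin[OF p] by (simp add: deriv_along_def bilinear_rmul algebra_simps)
qed

lemma is_levi_civita_torsion_free:
  "is_levi_civita U g D \<Longrightarrow> smooth_on X U \<Longrightarrow> smooth_on Y U \<Longrightarrow> p \<in> U
    \<Longrightarrow> D X Y p - D Y X p = lie_bracket X Y p"
  unfolding is_levi_civita_def by blast

lemma is_levi_civita_compatible:
  "is_levi_civita U g D \<Longrightarrow> smooth_on X U \<Longrightarrow> smooth_on Y U \<Longrightarrow> smooth_on Z U \<Longrightarrow> p \<in> U
    \<Longrightarrow> deriv_along X (\<lambda>q. g q (Y q) (Z q)) p = g p (D X Y p) (Z p) + g p (Y p) (D X Z p)"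
  unfolding is_levi_civita_def by blast

lemma levi_civita_unique:
  assumes g: "semi_riemannian_manifold U g"
    and D: "is_levi_civita U g D" and D': "is_levi_civita U g D'"
    and X: "smooth_on X U" and Y: "smooth_on Y U" and p: "p \<in> U"
  shows "D X Y p = D' X Y p"
proof -
  interpret gl: linear "\<lambda>v. g p v w" for w
    using g p by (auto simp: semi_riemannian_manifold_def bilinear_def)
  interpret gr: linear "\<lambda>w. g p v w" for v
    using g p by (auto simp: semi_riemannian_manifold_def bilinear_def)
  have g_sym: "g p v w = g p w v" for v w
    using g p by (auto simp: semi_riemannian_manifold_def)
  have nondegenerate: "v = 0" if "\<forall>w. g p v w = 0" for v
    using g p that by (simp add: semi_riemannian_manifold_def)
  define S where "S X Y Z = g p (D X Y p - D' X Y p) (Z p)" for X Y Z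
  \<comment> \<open>Symmetric in the first pair and skew in the last pair, hence zero.\<close>
  have sym: "S X Y Z = S Y X Z" if "smooth_on X U" "smooth_on Y U" for X Y Z
  proof -
    have "D X Y p - D Y X p = D' X Y p - D' Y X p"
      using is_levi_civita_torsion_free[OF D that p] is_levi_civita_torsion_free[OF D' that p] by simp
    then have "D X Y p - D' X Y p = D Y X p - D' Y X p" by (simp add: algebra_simps)
    then show ?thesis by (simp add: S_def)
  qed
  have skew: "S X Y Z = - S X Z Y" if "smooth_on X U" "smooth_on Y U" "smooth_on Z U" for X Y Z
  proof -
    have "g p (D X Y p) (Z p) + g p (Y p) (D X Z p) = g p (D' X Y p) (Z p) + g p (Y p) (D' X Z p)"
      using is_levi_civita_compatible[OF D that p] is_levi_civita_compatible[OF D' that p] by simp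
    then show ?thesis
      by (simp add: S_def gl.diff g_sym[of "Y p"])
  qed
  have "g p (D X Y p - D' X Y p) z = 0" for z
  proof -
    \<comment> \<open>A constant field extends the tangent vector \<open>z\<close> smoothly, so
      compatibility with fields controls every vector.\<close>
    let ?Z = "\<lambda>_ :: 'a. z"
    have Z: "smooth_on ?Z U" by (rule smooth_on_const)
    \<comment> \<open>Six alternating swaps lead back to the same triple: the three skew ones
      contribute a sign each, the three symmetric ones none.\<close>
    have "S X Y ?Z = - S X Y ?Z"
      using skew[OF X Y Z] sym[OF X Z, of Y] skew[OF Z X Y] sym[OF Z Y, of X] skew[OF Y Z X]
        sym[OF Y X, of ?Z] by linarith
    then show ?thesis by (simp add: S_def)
  qed
  then have "D X Y p - D' X Y p = 0" using nondegenerate by blast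
  then show ?thesis by simp
qed

lemma is_levi_civita_levi_civita: "is_levi_civita U g D \<Longrightarrow> is_levi_civita U g (levi_civita U g)"
  unfolding levi_civita_def by (rule someI[of "is_levi_civita U g"])

lemma levi_civita_eq:
  assumes "semi_riemannian_manifold U g" "is_levi_civita U g D"
    and "smooth_on X U" "smooth_on Y U" "p \<in> U"
  shows "levi_civita U g X Y p = D X Y p"
  using levi_civita_unique[OF assms(1) is_levi_civita_levi_civita] assms(2-) by blast

text \<open>Locality is needed since the two connections agree on \<open>U\<close> only, and \<open>D X\<close> is applied to
  \<open>levi_civita U g Y Z\<close>.\<close>

lemma curvature_field_eq:
  assumes g: "semi_riemannian_manifold U g" and D: "is_levi_civita U g D"
    and X: "smooth_on X U" and Y: "smooth_on Y U" and Z: "smooth_on Z U" and p: "p \<in> U"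
    and loc: "\<And>X Y Y' p. p \<in> U \<Longrightarrow> (\<And>q. q \<in> U \<Longrightarrow> Y q = Y' q) \<Longrightarrow> D X Y p = D X Y' p"
  shows "curvature_field U g X Y Z p =
    D (lie_bracket X Y) Z p - D X (D Y Z) p + D Y (D X Z) p"
proof -
  let ?L = "levi_civita U g"
  have "open U" using g by (simp add: semi_riemannian_manifold_def)
  have smooth: "smooth_on (?L X Y) U" if "smooth_on X U" "smooth_on Y U" for X Y
    using is_levi_civita_levi_civita[OF D] that by (simp add: is_levi_civita_def affine_connection_def)
  note eq = levi_civita_eq[OF g D]
  have "?L X (?L Y Z) p = D X (D Y Z) p" if "smooth_on X U" "smooth_on Y U" for X Y
    using eq[OF that(1) smooth[OF that(2) Z] p] loc[OF p, of "?L Y Z" "D Y Z"] eq[OF that(2) Z]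
    by simp
  then show ?thesis
    using eq[OF smooth_on_lie_bracket[OF \<open>open U\<close> X Y] Z p] X Y
    by (simp add: curvature_field_def Let_def)
qed

text \<open>All smooth extensions give the same value by assumption; constant fields show that
  extensions exist, so no second value can satisfy the \<open>THE\<close>.\<close>

lemma curvature_tensor_eqI:
  assumes "\<And>X Y Z. smooth_on X U \<Longrightarrow> smooth_on Y U \<Longrightarrow> smooth_on Z U \<Longrightarrow>
    curvature_field U g X Y Z p = r (X p) (Y p) (Z p)"
  shows "curvature_tensor U g p x y z = r x y z"
  unfolding curvature_tensor_def
proof (rule the_equality)
  fix s
  assume "\<forall>X Y Z. smooth_on X U \<longrightarrow> smooth_on Y U \<longrightarrow> smooth_on Z U \<longrightarrow>
    X p = x \<longrightarrow> Y p = y \<longrightarrow> Z p = z \<longrightarrow> curvature_field U g X Y Z p = s"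
  from this[rule_format, of "\<lambda>_. x" "\<lambda>_. y" "\<lambda>_. z"]
    assms[of "\<lambda>_. x" "\<lambda>_. y" "\<lambda>_. z"]
  show "s = r x y z" by (simp add: smooth_on_const)
qed (auto simp: assms)

text \<open>\<open>L\<close> carries negative definite subspaces to negative definite ones of equal
  dimension, and \<open>M\<close> carries them back. The two sets of dimensions agree before any
  maximum is taken.\<close>

lemma form_index_eq_isometry:
  fixes L M :: "'a::euclidean_space \<Rightarrow> 'a"
  assumes "linear L" "linear M" "\<And>v. M (L v) = v" "\<And>v. L (M v) = v"
    and iso: "\<And>v w. b' (L v) (L w) = b v w"
  shows "form_index b = form_index b'"
proof -
  have sub: "{dim W | W. subspace W \<and> (\<forall>w\<in>W. w \<noteq> 0 \<longrightarrow> c w w < 0)} \<subseteq>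
      {dim W | W. subspace W \<and> (\<forall>w\<in>W. w \<noteq> 0 \<longrightarrow> c' w w < 0)}"
    if "linear L" "\<And>v. M (L v) = v" "\<And>v w. c' (L v) (L w) = c v w"
    for L M :: "'a \<Rightarrow> 'a" and c c' :: "'a \<Rightarrow> 'a \<Rightarrow> real"
  proof safe
    fix W :: "'a set"
    assume W: "subspace W" "\<forall>w\<in>W. w \<noteq> 0 \<longrightarrow> c w w < 0"
    have "inj_on L S" for S using that(2) by (metis inj_onI)
    then have "dim (L ` W) = dim W" by (rule dim_image_eq[OF that(1)])
    moreover have "subspace (L ` W)" using that(1) W(1) by (rule linear_subspace_image)
    moreover have "\<forall>w\<in>L ` W. w \<noteq> 0 \<longrightarrow> c' w w < 0"
      using W(2) that(3) linear_0[OF that(1)] by auto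
    ultimately show "\<exists>V. dim W = dim V \<and> subspace V \<and> (\<forall>w\<in>V. w \<noteq> 0 \<longrightarrow> c' w w < 0)"
      by metis
  qed
  have "b (M v) (M w) = b' v w" for v w using iso[of "M v" "M w"] assms(4) by simp
  then show ?thesis
    unfolding form_index_def
    using sub[of L M b' b, OF assms(1,3) iso] sub[of M L b b', OF assms(2,4)] by (simp add: subset_antisym)
qed

subsection \<open>Traces\<close>

lemma linear_trace_add: "linear_trace (\<lambda>z. f z + h z) = linear_trace f + linear_trace h"
  by (simp add: linear_trace_def inner_add_left sum.distrib)

lemma linear_trace_diff: "linear_trace (\<lambda>z. f z - h z) = linear_trace f - linear_trace h"
  by (simp add: linear_trace_def inner_diff_left sum_subtractf)

lemma linear_trace_scaleR: "linear_trace (\<lambda>z. c *\<^sub>R f z) = c * linear_trace f"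
  by (simp add: linear_trace_def sum_distrib_left)

lemma linear_trace_rank_one:
  assumes "linear \<phi>"
  shows "linear_trace (\<lambda>z. \<phi> z *\<^sub>R a) = \<phi> a"
proof -
  have "\<phi> a = \<phi> (\<Sum>b\<in>Basis. (a \<bullet> b) *\<^sub>R b)" by (simp add: euclidean_representation)
  also have "\<dots> = (\<Sum>b\<in>Basis. (a \<bullet> b) * \<phi> b)"
    by (simp add: linear_sum[OF assms] linear_cmul[OF assms])
  finally show ?thesis by (simp add: linear_trace_def mult.commute)
qed

lemma sum_Basis_matrix:
  "(\<Sum>b\<in>(Basis :: (real^'n^'m) set). f b) = (\<Sum>i\<in>UNIV. \<Sum>j\<in>UNIV. f (axis i (axis j 1)))"
proof -
  let ?e = "\<lambda>(i, j). axis i (axis j 1) :: real^'n^'m"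
  have "Basis = ?e ` (UNIV \<times> UNIV)"
    by (auto simp: Basis_vec_def)
  moreover have "inj_on ?e (UNIV \<times> UNIV)"
    by (auto simp: inj_on_def axis_eq_axis)
  ultimately have "(\<Sum>b\<in>Basis. f b) = (\<Sum>x\<in>UNIV \<times> UNIV. f (?e x))"
    using sum.reindex[of ?e "UNIV \<times> UNIV" f] by (simp only: o_def)
  also have "\<dots> = (\<Sum>(i, j)\<in>UNIV \<times> UNIV. f (axis i (axis j 1)))"
    by (rule sum.cong) auto
  finally show ?thesis by (simp only: sum.cartesian_product)
qed

text \<open>If E is the matrix unit at (i, j), the (i, j) entry of B E C is
  \<open>B $ i $ i * C $ j $ j\<close>, and the double sum over units factors.\<close>

lemma linear_trace_matrix_mult:
  fixes B C :: "real^'n^'n"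
  shows "linear_trace (\<lambda>Z. B ** Z ** C) = trace B * trace C"
proof -
  let ?E = "\<lambda>i j. axis i (axis j 1) :: real^'n^'n"
  have BE: "(B ** ?E i j) $ k $ l = (if l = j then B $ k $ i else 0)" for i j k l
  proof -
    have "(B ** ?E i j) $ k $ l = (\<Sum>m\<in>UNIV. B $ k $ m * ?E i j $ m $ l)"
      by (simp add: matrix_matrix_mult_def)
    also have "\<dots> = (\<Sum>m\<in>UNIV. if m = i then B $ k $ i * axis j 1 $ l else 0)"
      by (intro sum.cong) (auto simp: axis_def)
    finally show ?thesis by (simp add: axis_def)
  qed
  have "(B ** ?E i j ** C) \<bullet> ?E i j = B $ i $ i * C $ j $ j" for i j
  proof -
    have "(B ** ?E i j ** C) \<bullet> ?E i j = (\<Sum>m\<in>UNIV. (B ** ?E i j) $ i $ m * C $ m $ j)"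
      by (simp add: inner_axis matrix_matrix_mult_def[of "B ** ?E i j"])
    also have "\<dots> = (\<Sum>m\<in>UNIV. if m = j then B $ i $ i * C $ j $ j else 0)"
      by (intro sum.cong) (auto simp: BE)
    finally show ?thesis by simp
  qed
  then show ?thesis
    by (simp add: linear_trace_def sum_Basis_matrix trace_def sum_product)
qed

subsection \<open>The metric on the general linear group\<close>

lemma bounded_bilinear_matrix_mult:
  "bounded_bilinear ((**) :: real^'n^'n \<Rightarrow> real^'n^'n \<Rightarrow> real^'n^'n)"
  unfolding bilinear_conv_bounded_bilinear[symmetric] bilinear_def
  by (auto intro!: linearI
      simp: matrix_matrix_mult_def vec_eq_iff algebra_simps sum.distrib sum_distrib_left)

interpretation matrix_mult: bounded_bilinear "(**) :: real^'n^'n \<Rightarrow> real^'n^'n \<Rightarrow> real^'n^'n"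
  by (rule bounded_bilinear_matrix_mult)

lemma linear_matrix_trace: "linear (trace :: real^'n^'n \<Rightarrow> real)"
  by (rule linearI) (simp_all add: trace_def sum.distrib sum_distrib_left)

lemma bounded_linear_trace: "bounded_linear (trace :: real^'n^'n \<Rightarrow> real)"
  using linear_matrix_trace by (simp add: linear_conv_bounded_linear)

lemmas matrix_simps = matrix_mult.add_left matrix_mult.add_right matrix_mult.diff_left
  matrix_mult.diff_right matrix_mult.minus_left matrix_mult.minus_right
  matrix_mult.scaleR_left matrix_mult.scaleR_right matrix_mul_assoc

lemmas trace_simps = trace_add trace_sub linear_neg[OF linear_matrix_trace]
  linear_cmul[OF linear_matrix_trace]

section \<open>Matrix inversion on the open set of invertible matrices\<close>

lemma matrix_inv_mult:
  assumes "A \<in> GL"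
  shows "A ** matrix_inv A = mat 1" "matrix_inv A ** A = mat 1"
proof -
  have "\<exists>B. A ** B = mat 1 \<and> B ** A = mat 1"
    using assms by (simp add: GL_def invertible_def)
  from someI_ex[OF this] show "A ** matrix_inv A = mat 1" "matrix_inv A ** A = mat 1"
    unfolding matrix_inv_def by auto
qed

text \<open>Products are normalised to left association, where an inner pair of inverse factors
  appears only behind a prefix \<open>B\<close>.\<close>

lemma matrix_inv_mult_cancel:
  assumes "A \<in> (GL :: (real^'n^'n) set)"
  shows "B ** A ** matrix_inv A = B" "B ** matrix_inv A ** A = (B :: real^'n^'n)"
  by (simp_all add: matrix_mul_assoc[symmetric] matrix_inv_mult[OF assms])

lemma continuous_on_det:
  fixes M :: "'a::topological_space \<Rightarrow> real^'n^'n"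
  assumes "\<And>i j. continuous_on S (\<lambda>x. M x $ i $ j)"
  shows "continuous_on S (\<lambda>x. det (M x))"
  unfolding det_def by (intro continuous_intros assms)

lemma open_GL: "open (GL :: (real^'n^'n) set)"
proof -
  have "continuous_on UNIV (det :: real^'n^'n \<Rightarrow> real)"
    by (rule continuous_on_det) (intro continuous_intros)
  then show ?thesis
    unfolding GL_def invertible_det_nz by (intro open_Collect_neq continuous_on_const)
qed

text \<open>Serves the continuity of inversion: every entry becomes a quotient of determinants with
  nonzero denominator. Column \<open>l\<close> of the inverse solves the linear system with right
  side \<open>axis l 1\<close>.\<close>

lemma matrix_inv_cramer:
  fixes A :: "real^'n^'n"
  assumes "A \<in> GL"
  shows "matrix_inv A $ k $ l =
    det (\<chi> i j. if j = k then axis l 1 $ i else A $ i $ j) / det A"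
proof -
  have "A *v column l (matrix_inv A) = column l (A ** matrix_inv A)"
    by (simp add: column_def matrix_vector_mult_def matrix_matrix_mult_def)
  also have "\<dots> = axis l 1"
    by (simp add: matrix_inv_mult[OF assms] column_def mat_def axis_def)
  finally have "column l (matrix_inv A) =
      (\<chi> k. det (\<chi> i j. if j = k then axis l 1 $ i else A $ i $ j) / det A)"
    using cramer[of A "column l (matrix_inv A)" "axis l 1"] assms
    by (simp add: GL_def invertible_det_nz)
  then show ?thesis by (simp add: column_def vec_eq_iff)
qed

lemma continuous_on_matrix_inv: "continuous_on GL (matrix_inv :: real^'n^'n \<Rightarrow> _)"
proof -
  have "continuous_on GL (\<lambda>A :: real^'n^'n. matrix_inv A $ k $ l)" for k l
  proof -
    have "continuous_on GL (\<lambda>A :: real^'n^'n.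
        det (\<chi> i j. if j = k then axis l 1 $ i else A $ i $ j) / det A)"
    proof (intro continuous_on_divide continuous_on_det)
      show "continuous_on GL (\<lambda>A. (\<chi> i j. if j = k then axis l 1 $ i else A $ i $ j) $ i $ j)"
        for i j by (cases "j = k") (auto intro!: continuous_intros)
    qed (auto intro!: continuous_intros simp: GL_def invertible_det_nz)
    then show ?thesis by (simp add: matrix_inv_cramer cong: continuous_on_cong)
  qed
  then have "continuous_on GL (\<lambda>A :: real^'n^'n. \<chi> k l. matrix_inv A $ k $ l)"
    by (intro continuous_on_vec_lambda)
  then show ?thesis by simp
qed

text \<open>Writing A(q) for the inverse, A(q) - A(p) = - A(q) (q - p) A(p). Replacing A(q) by A(p)
  on the right gives the derivative, with error - (A(q) - A(p)) (q - p) A(p), which is o(q - p) by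
  continuity of inversion.\<close>

lemma has_derivative_matrix_inv:
  fixes p :: "real^'n^'n"
  assumes "p \<in> GL"
  shows "(matrix_inv has_derivative (\<lambda>u. - (matrix_inv p ** u ** matrix_inv p))) (at p)"
proof -
  let ?A = "matrix_inv :: real^'n^'n \<Rightarrow> _"
  obtain K where K: "K > 0" "\<And>(a :: real^'n^'n) (b :: real^'n^'n). norm (a ** b) \<le> norm a * norm b * K"
    using matrix_mult.pos_bounded by auto
  define H where "H q = norm (?A q - ?A p) * norm (?A p) * K\<^sup>2" for q
  obtain e where e: "e > 0" "ball p e \<subseteq> GL"
    using openE[OF open_GL assms] .
  have "isCont ?A p"
    using bspec[OF iffD1[OF continuous_on_eq_continuous_at[OF open_GL] continuous_on_matrix_inv] assms] .
  then have "(H \<longlongrightarrow> norm (?A p - ?A p) * norm (?A p) * K\<^sup>2) (at p)"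
    unfolding H_def isCont_def by (intro tendsto_intros)
  then have lim: "(H \<longlongrightarrow> 0) (at p)" by simp
  have bound: "norm (?A q - ?A p - (- (?A p ** (q - p) ** ?A p))) / norm (q - p) \<le> H q"
    if "q \<noteq> p" "dist q p < e" for q
  proof -
    have q: "q \<in> GL" using e that by (auto simp: dist_commute)
    have "?A q - ?A p - (- (?A p ** (q - p) ** ?A p)) = - ((?A q - ?A p) ** (q - p) ** ?A p)"
      by (simp only: matrix_simps matrix_inv_mult[OF q] matrix_inv_mult[OF assms]
          matrix_inv_mult_cancel[OF assms] matrix_mul_lid) simp
    also have "norm \<dots> \<le> norm ((?A q - ?A p) ** (q - p)) * norm (?A p) * K"
      using K(2) by simp
    also have "\<dots> \<le> norm (?A q - ?A p) * norm (q - p) * K * norm (?A p) * K"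
      using K by (intro mult_right_mono) auto
    also have "\<dots> = H q * norm (q - p)" by (simp add: H_def power2_eq_square)
    finally show ?thesis using that by (simp add: divide_le_eq)
  qed
  have "bounded_linear (\<lambda>u. - (?A p ** u ** ?A p))"
    by (intro bounded_linear_minus matrix_mult.bounded_linear_left
        bounded_linear_compose[OF matrix_mult.bounded_linear_left matrix_mult.bounded_linear_right])
  then show ?thesis
    using has_derivativeI_sandwich[OF \<open>e > 0\<close> _ bound lim] by simp
qed

lemma smooth_on_matrix_mult:
  fixes X Y :: "'a::euclidean_space \<Rightarrow> real^'n^'n"
  shows "open U \<Longrightarrow> smooth_on X U \<Longrightarrow> smooth_on Y U \<Longrightarrow> smooth_on (\<lambda>p. X p ** Y p) U"
  by (rule smooth_on_bounded_bilinear[OF _ bounded_bilinear_matrix_mult])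

text \<open>A bootstrap: the derivative is polynomial in the inverse itself, so being
  \<open>Ck_on k\<close> yields the next level.\<close>

lemma smooth_on_matrix_inv: "smooth_on matrix_inv (GL :: (real^'n^'n) set)"
  unfolding smooth_on_def
proof
  fix k
  show "Ck_on k matrix_inv (GL :: (real^'n^'n) set)"
  proof (induction k)
    case 0
    then show ?case by (simp add: continuous_on_matrix_inv)
  next
    case (Suc k)
    have "Ck_on k (\<lambda>p. - (matrix_inv p ** u ** matrix_inv p)) GL" for u :: "real^'n^'n"
      by (intro Ck_on_bounded_linear[OF open_GL, of uminus]
          Ck_on_bounded_bilinear[OF open_GL bounded_bilinear_matrix_mult] Suc Ck_on_const
          bounded_linear_minus bounded_linear_ident)
    then show ?case
      by (intro Ck_on_SucI[OF open_GL has_derivative_matrix_inv])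
  qed
qed

section \<open>Symmetry, nondegeneracy and index of the metric\<close>

lemma gl_metric_commute: "gl_metric p v w = gl_metric p w v"
  unfolding gl_metric_def
  using trace_mul_sym[of "matrix_inv p ** v" "matrix_inv p ** w"] by (simp add: matrix_mul_assoc)

text \<open>With M = \<open>matrix_inv p ** v\<close>, the test vector
  \<open>p ** transpose M\<close> turns the metric into tr (M M^T), the sum of the squared entries
  of M.\<close>

lemma gl_metric_nondegenerate:
  fixes p :: "real^'n^'n"
  assumes "p \<in> GL" "\<And>w. gl_metric p v w = 0"
  shows "v = 0"
proof -
  let ?M = "matrix_inv p ** v"
  have "(\<Sum>i\<in>UNIV. \<Sum>j\<in>UNIV. (?M $ i $ j)\<^sup>2) = trace (?M ** transpose ?M)"
    by (simp add: trace_def matrix_matrix_mult_def transpose_def power2_eq_square)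
  also have "\<dots> = gl_metric p v (p ** transpose ?M)"
    by (simp add: gl_metric_def matrix_mul_assoc matrix_inv_mult_cancel[OF assms(1)])
  finally have "(\<Sum>i\<in>UNIV. \<Sum>j\<in>UNIV. (?M $ i $ j)\<^sup>2) = 0" using assms(2) by simp
  then have "?M = 0"
    by (simp add: sum_nonneg_eq_0_iff sum_nonneg vec_eq_iff)
  then have "p ** ?M = 0" by simp
  then show ?thesis by (simp add: matrix_mul_assoc matrix_inv_mult[OF assms(1)])
qed

lemma form_index_gl_metric:
  fixes p q :: "real^'n^'n"
  assumes "p \<in> GL" "q \<in> GL"
  shows "form_index (gl_metric p) = form_index (gl_metric q)"
proof (rule form_index_eq_isometry)
  \<comment> \<open>Left translation from \<open>p\<close> to \<open>q\<close> and back: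
    \<open>matrix_inv q ** (q ** matrix_inv p ** v)\<close> is \<open>matrix_inv p ** v\<close>, so
    the traces agree.\<close>
  show "linear (\<lambda>v :: real^'n^'n. q ** matrix_inv p ** v)"
    "linear (\<lambda>v :: real^'n^'n. p ** matrix_inv q ** v)"
    by (simp_all add: linear_conv_bounded_linear matrix_mult.bounded_linear_right)
qed (simp_all add: gl_metric_def matrix_mul_assoc matrix_inv_mult_cancel matrix_inv_mult assms)

lemma semi_riemannian_manifold_gl: "semi_riemannian_manifold GL gl_metric"
  unfolding semi_riemannian_manifold_def
proof (intro conjI ballI allI impI)
  show "smooth_on (\<lambda>p. gl_metric p v w) GL" for v w :: "real^'n^'n"
    unfolding gl_metric_def
    by (intro smooth_on_bounded_linear[OF open_GL bounded_linear_trace]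
        smooth_on_matrix_mult[OF open_GL] smooth_on_matrix_inv smooth_on_const)
  show "bilinear (gl_metric p)" for p :: "real^'n^'n"
    by (auto simp: bilinear_def gl_metric_def matrix_simps trace_simps intro!: linearI)
  show "v = 0" if "p \<in> GL" "\<forall>w. gl_metric p v w = 0" for p v :: "real^'n^'n"
    using gl_metric_nondegenerate that by blast
qed (rule open_GL gl_metric_commute form_index_gl_metric; assumption)+

subsection \<open>Connection and curvature of the general linear group\<close>

text \<open>The symmetrised half of the derivative of inversion. On left-invariant fields
  \<open>p ** a\<close> and \<open>p ** b\<close> the resulting connection is half the Lie bracket,
  as for every bi-invariant metric; symmetry in \<open>v\<close> and \<open>w\<close> makes the
  torsion vanish.\<close>

definition gl_christoffel :: "real^'n^'n \<Rightarrow> real^'n^'n \<Rightarrow> real^'n^'n \<Rightarrow> real^'n^'n" where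
  "gl_christoffel p v w = - (1/2) *\<^sub>R (v ** matrix_inv p ** w + w ** matrix_inv p ** v)"

definition gl_connection ::
  "(real^'n^'n \<Rightarrow> real^'n^'n) \<Rightarrow> (real^'n^'n \<Rightarrow> real^'n^'n) \<Rightarrow> real^'n^'n \<Rightarrow> real^'n^'n" where
  "gl_connection X Y p = deriv_along X Y p + gl_christoffel p (X p) (Y p)"

lemma has_derivative_matrix_mult:
  assumes "(X has_derivative X') (at p)" "(Y has_derivative Y') (at p)"
  shows "((\<lambda>q. (X q :: real^'n^'n) ** (Y q :: real^'n^'n)) has_derivative
    (\<lambda>u. X p ** Y' u + X' u ** Y p)) (at p)"
  by (rule matrix_mult.FDERIV[OF assms])

lemma smooth_on_gl_christoffel:
  fixes X Y :: "real^'n^'n \<Rightarrow> real^'n^'n"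
  assumes "smooth_on X GL" "smooth_on Y GL"
  shows "smooth_on (\<lambda>p. gl_christoffel p (X p) (Y p)) GL"
  unfolding gl_christoffel_def
  by (intro smooth_on_scaleR[OF open_GL] smooth_on_const smooth_on_add[OF open_GL]
      smooth_on_matrix_mult[OF open_GL] smooth_on_matrix_inv assms)

lemma affine_connection_gl: "affine_connection (GL :: (real^'n^'n) set) gl_connection"
proof -
  have "bilinear (gl_christoffel p)" for p :: "real^'n^'n"
    by (auto simp: bilinear_def gl_christoffel_def matrix_simps algebra_simps intro!: linearI)
  then show ?thesis
    unfolding gl_connection_def[abs_def]
    by (intro affine_connection_christoffel open_GL smooth_on_gl_christoffel)
qed

text \<open>Differentiating the two inverses produces - tr (A u A Y A Z) and - tr (A Y A u A Z).
  Each \<open>gl_christoffel\<close> term accounts for one half of both, so the derivative already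
  has the shape of metric compatibility.\<close>

lemma has_derivative_gl_metric:
  fixes Y Z :: "real^'n^'n \<Rightarrow> real^'n^'n"
  assumes "p \<in> GL" "(Y has_derivative Y') (at p)" "(Z has_derivative Z') (at p)"
  shows "((\<lambda>q. gl_metric q (Y q) (Z q)) has_derivative
    (\<lambda>u. gl_metric p (Y' u + gl_christoffel p u (Y p)) (Z p)
      + gl_metric p (Y p) (Z' u + gl_christoffel p u (Z p)))) (at p)"
proof -
  let ?A = "matrix_inv p"
  have "((\<lambda>q. gl_metric q (Y q) (Z q)) has_derivative
    (\<lambda>u. trace (?A ** Y p ** ?A ** Z' u
      + (?A ** Y p ** - (?A ** u ** ?A)
        + (?A ** Y' u + - (?A ** u ** ?A) ** Y p) ** ?A) ** Z p))) (at p)"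
    unfolding gl_metric_def
    by (intro bounded_linear.has_derivative[OF bounded_linear_trace] has_derivative_matrix_mult
        has_derivative_matrix_inv assms)
  \<comment> \<open>Cyclicity matches the product with \<open>u\<close> last, coming from the term
    in \<open>Z\<close>, with the product with \<open>u\<close> first.\<close>
  moreover have "trace (?A ** Y p ** ?A ** Z p ** ?A ** u) = trace (?A ** u ** ?A ** Y p ** ?A ** Z p)"
    for u
    using trace_mul_sym[of "?A ** Y p ** ?A ** Z p" "?A ** u"] by (simp add: matrix_mul_assoc)
  ultimately show ?thesis
    by (simp add: gl_metric_def gl_christoffel_def matrix_simps trace_simps algebra_simps)
qed

lemma is_levi_civita_gl: "is_levi_civita (GL :: (real^'n^'n) set) gl_metric gl_connection"
  unfolding is_levi_civita_def
proof (intro conjI allI impI ballI)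
  fix X Y Z :: "real^'n^'n \<Rightarrow> real^'n^'n" and p :: "real^'n^'n"
  assume "p \<in> GL" "smooth_on Y GL" "smooth_on Z GL"
  then show "deriv_along X (\<lambda>q. gl_metric q (Y q) (Z q)) p =
      gl_metric p (gl_connection X Y p) (Z p) + gl_metric p (Y p) (gl_connection X Z p)"
    unfolding deriv_along_def[of X "\<lambda>q. gl_metric q (Y q) (Z q)"]
    by (subst frechet_derivative_eqI[OF has_derivative_gl_metric[OF _
            smooth_on_has_derivative smooth_on_has_derivative]])
      (auto simp: gl_connection_def deriv_along_def)
qed (simp_all add: affine_connection_gl gl_connection_def lie_bracket_def gl_christoffel_def
    add.commute)

section \<open>Curvature and its two contractions\<close>

lemma has_derivative_gl_christoffel:
  fixes Y Z :: "real^'n^'n \<Rightarrow> real^'n^'n"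
  assumes "p \<in> GL" "(Y has_derivative Y') (at p)" "(Z has_derivative Z') (at p)"
  shows "((\<lambda>q. gl_christoffel q (Y q) (Z q)) has_derivative
    (\<lambda>u. gl_christoffel p (Y' u) (Z p) + gl_christoffel p (Y p) (Z' u)
      + (1/2) *\<^sub>R (Y p ** matrix_inv p ** u ** matrix_inv p ** Z p
        + Z p ** matrix_inv p ** u ** matrix_inv p ** Y p))) (at p)"
proof -
  let ?A = "matrix_inv p"
  have "((\<lambda>q. gl_christoffel q (Y q) (Z q)) has_derivative
    (\<lambda>u. - (1/2) *\<^sub>R ((Y p ** ?A ** Z' u + (Y p ** - (?A ** u ** ?A) + Y' u ** ?A) ** Z p)
      + (Z p ** ?A ** Y' u + (Z p ** - (?A ** u ** ?A) + Z' u ** ?A) ** Y p)))) (at p)"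
    unfolding gl_christoffel_def
    by (intro has_derivative_scaleR_right has_derivative_add has_derivative_matrix_mult
        has_derivative_matrix_inv assms)
  then show ?thesis
    by (simp add: gl_christoffel_def matrix_simps algebra_simps)
qed

lemma curvature_field_gl:
  fixes X Y Z :: "real^'n^'n \<Rightarrow> real^'n^'n"
  assumes p: "p \<in> GL" and X: "smooth_on X GL" and Y: "smooth_on Y GL" and Z: "smooth_on Z GL"
  defines "A \<equiv> matrix_inv p"
  shows "curvature_field GL gl_metric X Y Z p =
    (1/4) *\<^sub>R (X p ** A ** Y p ** A ** Z p - Y p ** A ** X p ** A ** Z p
      - Z p ** A ** X p ** A ** Y p + Z p ** A ** Y p ** A ** X p)"
proof -
  have loc: "gl_connection X Y p = gl_connection X Y' p"
    if "p \<in> GL" "\<And>q. q \<in> GL \<Longrightarrow> Y q = Y' q" for X Y Y' :: "real^'n^'n \<Rightarrow> real^'n^'n" and p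
    using frechet_derivative_cong_open[OF open_GL that] that
    by (simp add: gl_connection_def deriv_along_def)
  have nested: "gl_connection X (gl_connection Y Z) p =
      deriv_along X (deriv_along Y Z) p
      + gl_christoffel p (deriv_along X Y p) (Z p) + gl_christoffel p (Y p) (deriv_along X Z p)
      + (1/2) *\<^sub>R (Y p ** A ** X p ** A ** Z p + Z p ** A ** X p ** A ** Y p)
      + gl_christoffel p (X p) (deriv_along Y Z p + gl_christoffel p (Y p) (Z p))"
    if X: "smooth_on X GL" and Y: "smooth_on Y GL" for X Y
  proof -
    have "(gl_connection Y Z has_derivative
      (\<lambda>u. frechet_derivative (deriv_along Y Z) (at p) u +
        (gl_christoffel p (frechet_derivative Y (at p) u) (Z p)
        + gl_christoffel p (Y p) (frechet_derivative Z (at p) u)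
        + (1/2) *\<^sub>R (Y p ** A ** u ** A ** Z p + Z p ** A ** u ** A ** Y p)))) (at p)"
      unfolding gl_connection_def[abs_def] A_def
      by (intro has_derivative_add has_derivative_gl_christoffel smooth_on_has_derivative[OF _ p]
          smooth_on_deriv_along[OF open_GL] Y Z p)
    from frechet_derivative_eqI[OF this] show ?thesis
      by (simp add: gl_connection_def[of X] deriv_along_def[of X] gl_connection_def[of Y Z p])
  qed
  \<comment> \<open>The iterated derivatives of \<open>Z\<close> cancel against the derivative along
    the bracket, leaving only \<open>gl_christoffel\<close> and its derivative.\<close>
  have "gl_connection (lie_bracket X Y) Z p - gl_connection X (gl_connection Y Z) p
      + gl_connection Y (gl_connection X Z) p =
    gl_christoffel p (deriv_along X Y p - deriv_along Y X p) (Z p)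
      - (gl_christoffel p (deriv_along X Y p) (Z p) + gl_christoffel p (Y p) (deriv_along X Z p)
        + (1/2) *\<^sub>R (Y p ** A ** X p ** A ** Z p + Z p ** A ** X p ** A ** Y p)
        + gl_christoffel p (X p) (deriv_along Y Z p + gl_christoffel p (Y p) (Z p)))
      + (gl_christoffel p (deriv_along Y X p) (Z p) + gl_christoffel p (X p) (deriv_along Y Z p)
        + (1/2) *\<^sub>R (X p ** A ** Y p ** A ** Z p + Z p ** A ** Y p ** A ** X p)
        + gl_christoffel p (Y p) (deriv_along X Z p + gl_christoffel p (X p) (Z p)))"
    unfolding nested[OF X Y] nested[OF Y X] gl_connection_def[of "lie_bracket X Y"]
      deriv_along_lie_bracket[OF open_GL p X Y Z]
    by (simp add: lie_bracket_def algebra_simps)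
  \<comment> \<open>First derivatives cancel by bilinearity. The derivative of
    \<open>gl_christoffel\<close> gives coefficients of size 1/2, its composition with itself 1/4
    with the opposite sign; the products with \<open>Z\<close> in the middle cancel.\<close>
  also have "\<dots> = (1/4) *\<^sub>R (X p ** A ** Y p ** A ** Z p - Y p ** A ** X p ** A ** Z p
      - Z p ** A ** X p ** A ** Y p + Z p ** A ** Y p ** A ** X p)"
    unfolding gl_christoffel_def A_def[symmetric]
    by (rule euclidean_eqI) (simp add: matrix_simps inner_simps algebra_simps)
  finally show ?thesis
    by (simp add: curvature_field_eq[OF semi_riemannian_manifold_gl is_levi_civita_gl X Y Z p loc])
qed

lemma curvature_tensor_gl:
  fixes x y z :: "real^'n^'n"
  assumes "p \<in> GL"
  defines "A \<equiv> matrix_inv p"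
  shows "curvature_tensor GL gl_metric p x y z =
    (1/4) *\<^sub>R (x ** A ** y ** A ** z - y ** A ** x ** A ** z - z ** A ** x ** A ** y + z ** A ** y ** A ** x)"
  unfolding A_def by (rule curvature_tensor_eqI) (rule curvature_field_gl[OF assms(1)])

text \<open>The traced variable is the middle argument of the curvature. In two of the four products
  it stands between \<open>x\<close> and \<open>y\<close>, which splits the trace; in the other two
  it stands at an end, where the missing factor is the identity and contributes
  \<open>CARD('n)\<close>.\<close>

lemma ricci_gl:
  fixes x y :: "real^'n^'n"
  assumes "p \<in> GL"
  shows "ricci GL gl_metric p x y =
    1/2 * trace (matrix_inv p ** x) * trace (matrix_inv p ** y) - real CARD('n) / 2 * gl_metric p x y"
proof -
  let ?A = "matrix_inv p"
  have 1: "linear_trace (\<lambda>z :: real^'n^'n. x ** ?A ** z ** ?A ** y) = trace (?A ** x) * trace (?A ** y)"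
    using linear_trace_matrix_mult[of "x ** ?A" "?A ** y"] trace_mul_sym[of x ?A]
    by (simp add: matrix_mul_assoc)
  have 2: "linear_trace (\<lambda>z :: real^'n^'n. z ** ?A ** x ** ?A ** y) = real CARD('n) * gl_metric p x y"
    using linear_trace_matrix_mult[of "mat 1 :: real^'n^'n" "?A ** x ** ?A ** y"]
    by (simp add: matrix_mul_assoc gl_metric_def trace_I)
  have 3: "linear_trace (\<lambda>z :: real^'n^'n. y ** ?A ** x ** ?A ** z) = real CARD('n) * gl_metric p x y"
    using linear_trace_matrix_mult[of "y ** ?A ** x ** ?A" "mat 1 :: real^'n^'n"]
      trace_mul_sym[of y "?A ** x ** ?A"]
    by (simp add: matrix_mul_assoc gl_metric_def trace_I)
  have 4: "linear_trace (\<lambda>z :: real^'n^'n. y ** ?A ** z ** ?A ** x) = trace (?A ** x) * trace (?A ** y)"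
    using linear_trace_matrix_mult[of "y ** ?A" "?A ** x"] trace_mul_sym[of y ?A]
    by (simp add: matrix_mul_assoc)
  show ?thesis
    unfolding ricci_def curvature_tensor_gl[OF assms]
      linear_trace_scaleR linear_trace_add linear_trace_diff 1 2 3 4
    by (simp add: field_simps)
qed

lemma scalar_curvature_gl:
  fixes p :: "real^'n^'n"
  assumes p: "p \<in> GL"
  shows "scalar_curvature GL gl_metric p =
    - ((real CARD('n) + 1) * real CARD('n) * (real CARD('n) - 1) / 2)"
proof -
  let ?A = "matrix_inv p"
  \<comment> \<open>The matrix \<open>p\<close>, seen as a tangent vector at \<open>p\<close>,
    represents the functional \<open>trace (?A ** y)\<close>, because \<open>?A ** p\<close> is the
    identity. Raising an index in the Ricci formula thus gives \<open>Q\<close>.\<close>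
  define Q where "Q x = (1/2) *\<^sub>R (trace (?A ** x) *\<^sub>R p) - (real CARD('n) / 2) *\<^sub>R x" for x
  have Q: "gl_metric p (Q x) y = ricci GL gl_metric p x y" for x y
    unfolding ricci_gl[OF p]
    by (simp add: Q_def gl_metric_def matrix_simps trace_simps matrix_inv_mult[OF p])
  have "(THE w. \<forall>y. gl_metric p w y = ricci GL gl_metric p x y) = Q x" for x
  proof (rule the_equality)
    fix w assume "\<forall>y. gl_metric p w y = ricci GL gl_metric p x y"
    then have "gl_metric p (w - Q x) y = 0" for y
      by (simp add: gl_metric_def matrix_simps trace_simps flip: Q)
    from gl_metric_nondegenerate[OF p this] show "w = Q x" by simp
  qed (simp add: Q)
  then have "scalar_curvature GL gl_metric p = linear_trace Q"
    by (simp add: scalar_curvature_def metric_trace_def)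
  also have "\<dots> = 1/2 * trace (?A ** p) - real CARD('n) / 2 * linear_trace (\<lambda>x :: real^'n^'n. x)"
  proof -
    have "linear (\<lambda>x. trace (?A ** x))"
      by (intro linearI) (simp_all add: matrix_simps trace_simps)
    then show ?thesis
      by (simp only: Q_def[abs_def] linear_trace_diff linear_trace_scaleR linear_trace_rank_one)
  qed
  also have "linear_trace (\<lambda>x :: real^'n^'n. x) = real CARD('n) * real CARD('n)"
    using linear_trace_matrix_mult[of "mat 1 :: real^'n^'n" "mat 1"] by (simp add: trace_I)
  finally show ?thesis
    by (simp add: matrix_inv_mult[OF p] trace_I field_simps)
qed

theorem proposition3p2:
  shows "(\<forall>K \<in> (GL :: (real^'n^'n) set). \<forall>X Y :: real^'n^'n.
            ricci GL gl_metric K X Y =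
              1/2 * trace (matrix_inv K ** X) * trace (matrix_inv K ** Y)
              - real CARD('n) / 2 * gl_metric K X Y)
       \<and> semi_riemannian_manifold (GL :: (real^'n^'n) set) gl_metric
       \<and> (\<forall>K \<in> (GL :: (real^'n^'n) set).
            scalar_curvature GL gl_metric K =
              - ((real CARD('n) + 1) * real CARD('n) * (real CARD('n) - 1) / 2))"
  using ricci_gl semi_riemannian_manifold_gl scalar_curvature_gl by blast

end
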